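(* For every integer $n\ge 1$, $$m(n)\le B(n):=1+\sum_{d\mid n}\bigl|\mathrm{cycles}^{(1)}(d)\bigr|\,(d+n-2).$$
   Context: Let $n\ge1$ and $[n]=\{1,\dots,n\}$. A permutation $\pi\in S_n$ is identified with its one-line word $\pi(1)\pi(2)\cdots\pi(n)$. Let $\sigma\in S_n$ be the cycle $\sigma(i)=i+1$ for $i<n$, $\sigma(n)=1$; values and positions are taken modulo $n$ with representatives in $[n]$. For $\pi\in S_n$ let $\mathrm{inc}(\pi)=\{\sigma^k\circ\pi: 0\le k\le n-1\}$ (the permutations obtained from $\pi$ by adding a constant to every value modulo $n$), and let $\mathcal{R}_2$ be the equivalence relation $\pi\,\mathcal{R}_2\,\pi'\iff\pi'\in\mathrm{inc}(\pi)$; it has $(n-1)!$ classes. A word $u$ over $[n]$ is a universal word for $\mathcal{R}_2$ if for every $\pi\in S_n$ some contiguous factor $u(i)u(i+1)\cdots u(i+n-1)$ of $u$ equals the one-line word of some element of $\mathrm{inc}(\pi)$. $m(n)$ denotes the minimal length of a universal word for $\mathcal{R}_2$. The map $f(\mathrm{inc}(\pi))=\mathrm{inc}(\pi\circ\sigma)$ is a well-defined permutation of the set of $\mathcal{R}_2$-classes (on words, $\pi\circ\sigma=\pi(2)\cdots\pi(n)\pi(1)$). A 1-cycle is an orbit of $f$ (equivalently a cycle of weight-1 transitions in the paper's transition graph $H_n$ on the classes; a class fixed by $f$ is a 1-cycle of length 1). $\mathrm{cycles}^{(1)}(d)$ denotes the set of 1-cycles consisting of exactly $d$ classes. *)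

theory Defs
  imports Main "HOL-Library.Sublist" "HOL-Combinatorics.Combinatorics"
begin

text \<open>Elements of \<open>S\<^sub>n\<close> are functions \<open>\<pi>\<close> with \<open>\<pi> permutes {1..n}\<close>; in particular they fix every
  natural number outside \<open>{1..n}\<close>.\<close>

definition sigma :: "nat \<Rightarrow> nat \<Rightarrow> nat" where
  "sigma n i = (if i \<in> {1..n} then (if i < n then i + 1 else 1) else i)"

definition one_line :: "nat \<Rightarrow> (nat \<Rightarrow> nat) \<Rightarrow> nat list" where
  "one_line n \<pi> = map \<pi> [1..<n + 1]"

definition inc :: "nat \<Rightarrow> (nat \<Rightarrow> nat) \<Rightarrow> (nat \<Rightarrow> nat) set" where
  "inc n \<pi> = {(sigma n ^^ k) \<circ> \<pi> | k. k \<le> n - 1}"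

definition R2 :: "nat \<Rightarrow> (nat \<Rightarrow> nat) rel" where
  "R2 n = {(\<pi>, \<pi>'). \<pi> permutes {1..n} \<and> \<pi>' \<in> inc n \<pi>}"

definition R2_classes :: "nat \<Rightarrow> (nat \<Rightarrow> nat) set set" where
  "R2_classes n = {\<pi>. \<pi> permutes {1..n}} // R2 n"

definition universal_word :: "nat \<Rightarrow> nat list \<Rightarrow> bool" where
  "universal_word n u \<longleftrightarrow> set u \<subseteq> {1..n} \<and>
     (\<forall>\<pi>. \<pi> permutes {1..n} \<longrightarrow> (\<exists>\<rho> \<in> inc n \<pi>. sublist (one_line n \<rho>) u))"

definition min_universal_length :: "nat \<Rightarrow> nat" where
  "min_universal_length n = (LEAST l. \<exists>u. universal_word n u \<and> length u = l)"

text \<open>The map induced on classes by \<open>\<pi> \<mapsto> \<pi> \<circ> \<sigma>\<close>. The union is over representatives of a class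
  and all its members coincide; see \<open>rot_class_inc\<close> below.\<close>

definition rot_class :: "nat \<Rightarrow> (nat \<Rightarrow> nat) set \<Rightarrow> (nat \<Rightarrow> nat) set" where
  "rot_class n C = (\<Union>\<pi> \<in> C. inc n (\<pi> \<circ> sigma n))"

text \<open>The library's \<open>orbit f x\<close> consists of the iterates of \<open>x\<close> under at least one application of \<open>f\<close>.
  Since \<open>rot_class n\<close> permutes the finite set \<open>R2_classes n\<close>, this is the usual orbit.\<close>

definition cycles1 :: "nat \<Rightarrow> nat \<Rightarrow> (nat \<Rightarrow> nat) set set set" where
  "cycles1 n d = {orbit (rot_class n) C | C. C \<in> R2_classes n \<and> card (orbit (rot_class n) C) = d}"

lemma sigma_funpow:
  assumes "i \<in> {1..n}"
  shows "(sigma n ^^ k) i = (i - 1 + k) mod n + 1"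
proof (induction k)
  case 0
  then show ?case using assms by auto
next
  case (Suc k)
  have n: "n > 0" using assms by auto
  have "(sigma n ^^ Suc k) i = sigma n ((i - 1 + k) mod n + 1)"
    using Suc by simp
  also have "\<dots> = Suc (i - 1 + k) mod n + 1"
    using n mod_less_divisor[OF n, of "i - 1 + k"]
    by (auto simp: sigma_def mod_Suc Suc_le_eq)
  finally show ?case by simp
qed

lemma sigma_permutes: "sigma n permutes {1..n}"
proof (rule bij_imp_permutes)
  have inj: "inj_on (sigma n) {1..n}"
  proof (rule inj_onI)
    fix i j assume "i \<in> {1..n}" "j \<in> {1..n}" "sigma n i = sigma n j"
    then show "i = j" unfolding sigma_def atLeastAtMost_iff by presburger
  qed
  have "sigma n ` {1..n} \<subseteq> {1..n}"
  proof (rule image_subsetI)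
    fix i assume "i \<in> {1..n}"
    then show "sigma n i \<in> {1..n}" unfolding sigma_def atLeastAtMost_iff by presburger
  qed
  then have "sigma n ` {1..n} = {1..n}"
    using inj by (rule endo_inj_surj[OF finite_atLeastAtMost])
  then show "bij_betw (sigma n) {1..n} {1..n}"
    using inj by (rule bij_betw_imageI[rotated])
next
  fix i assume "i \<notin> {1..n}"
  then show "sigma n i = i" by (simp only: sigma_def if_False)
qed

lemma sigma_funpow_permutes: "(sigma n ^^ k) permutes {1..n}"
proof (induction k)
  case 0
  show ?case using permutes_id[of "{1..n}"] by (simp only: funpow.simps)
next
  case (Suc k)
  then show ?case using permutes_compose[OF Suc sigma_permutes] by (simp only: funpow.simps)
qed

lemma sigma_funpow_n: "sigma n ^^ n = id"
proof
  fix i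
  show "(sigma n ^^ n) i = id i"
  proof (cases "i \<in> {1..n}")
    case True
    have "i - 1 < n" "i - 1 + 1 = i" using True by auto
    then show ?thesis using sigma_funpow[OF True, of n]
      by (simp only: mod_add_self2 mod_less id_apply)
  next
    case False
    then show ?thesis using permutes_not_in[OF sigma_funpow_permutes] by auto
  qed
qed

lemma sigma_funpow_mod: "sigma n ^^ (k mod n) = sigma n ^^ k"
proof -
  have "sigma n ^^ k = sigma n ^^ (k mod n + n * (k div n))" by simp
  also have "\<dots> = sigma n ^^ (k mod n) \<circ> ((sigma n ^^ n) ^^ (k div n))"
    by (simp only: funpow_add funpow_mult)
  finally show ?thesis by (simp add: sigma_funpow_n)
qed

lemma inc_altdef:
  assumes "n \<ge> 1"
  shows "inc n \<pi> = range (\<lambda>k. (sigma n ^^ k) \<circ> \<pi>)"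
proof -
  have "(sigma n ^^ k) \<circ> \<pi> \<in> inc n \<pi>" for k
  proof -
    have "k mod n \<le> n - 1" using assms mod_less_divisor[of n k] by linarith
    then show ?thesis unfolding inc_def by (intro CollectI exI[of _ "k mod n"]) (simp add: sigma_funpow_mod)
  qed
  then show ?thesis by (auto simp: inc_def)
qed

lemma inc_self: "\<pi> \<in> inc n \<pi>"
  by (force simp: inc_def intro: exI[of _ 0])

lemma inc_permutes:
  assumes "\<pi> permutes {1..n}" "\<rho> \<in> inc n \<pi>"
  shows "\<rho> permutes {1..n}"
proof -
  obtain k where "\<rho> = (sigma n ^^ k) \<circ> \<pi>" using assms(2) by (auto simp: inc_def)
  then show ?thesis using permutes_compose[OF assms(1) sigma_funpow_permutes] by simp
qed

lemma inc_eq: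
  assumes n: "n \<ge> 1" and \<rho>: "\<rho> \<in> inc n \<pi>"
  shows "inc n \<rho> = inc n \<pi>"
proof -
  obtain k where k: "k \<le> n - 1" "\<rho> = (sigma n ^^ k) \<circ> \<pi>"
    using \<rho> by (auto simp: inc_def)
  have "(sigma n ^^ (n - k)) \<circ> \<rho> = (sigma n ^^ (n - k + k)) \<circ> \<pi>"
    unfolding k(2) by (simp only: funpow_add comp_assoc)
  also have "\<dots> = \<pi>" using k n by (simp add: sigma_funpow_n)
  finally have \<pi>_eq: "\<pi> = (sigma n ^^ (n - k)) \<circ> \<rho>" by simp
  have trans: "inc n ((sigma n ^^ j) \<circ> \<tau>) \<subseteq> inc n \<tau>" for j \<tau>
    by (auto simp: inc_altdef[OF n] comp_assoc[symmetric] funpow_add[symmetric])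
  show ?thesis
  proof (rule equalityI)
    show "inc n \<rho> \<subseteq> inc n \<pi>" using trans[of k \<pi>] by (simp only: k(2)[symmetric])
    show "inc n \<pi> \<subseteq> inc n \<rho>" using trans[of "n - k" \<rho>] by (simp only: \<pi>_eq[symmetric])
  qed
qed

lemma equiv_R2:
  assumes "n \<ge> 1"
  shows "equiv {\<pi>. \<pi> permutes {1..n}} (R2 n)"
proof (rule equivI)
  show "R2 n \<subseteq> {\<pi>. \<pi> permutes {1..n}} \<times> {\<pi>. \<pi> permutes {1..n}}"
    unfolding R2_def using inc_permutes by blast
  show "refl_on {\<pi>. \<pi> permutes {1..n}} (R2 n)"
    by (rule refl_onI) (simp add: R2_def inc_self)
  show "sym (R2 n)"
    unfolding sym_def R2_def using inc_permutes inc_eq[OF assms] inc_self by blast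
  show "trans (R2 n)"
    unfolding trans_def R2_def using inc_eq[OF assms] by blast
qed

lemma rot_class_inc:
  assumes n: "n \<ge> 1"
  shows "rot_class n (inc n \<pi>) = inc n (\<pi> \<circ> sigma n)"
proof -
  have "inc n (\<rho> \<circ> sigma n) = inc n (\<pi> \<circ> sigma n)" if "\<rho> \<in> inc n \<pi>" for \<rho>
    using that by (intro inc_eq[OF n]) (auto simp: inc_def comp_assoc)
  then show ?thesis unfolding rot_class_def using inc_self[of \<pi> n] by blast
qed

lemma universal_word_exists: "\<exists>u. universal_word n u"
proof -
  have "finite {\<pi>. \<pi> permutes {1..n}}" by (rule finite_permutations) simp
  then obtain ps where ps: "set ps = {\<pi>. \<pi> permutes {1..n}}" using finite_list by blast
  let ?u = "concat (map (one_line n) ps)"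
  have "sublist (one_line n \<pi>) ?u" if "\<pi> permutes {1..n}" for \<pi>
  proof -
    have "\<pi> \<in> set ps" using ps that by simp
    then obtain xs ys where "ps = xs @ \<pi> # ys" by (blast dest: split_list)
    then have "?u = concat (map (one_line n) xs) @ one_line n \<pi> @ concat (map (one_line n) ys)"
      by simp
    then show ?thesis unfolding sublist_def by blast
  qed
  moreover have "set ?u \<subseteq> {1..n}"
  proof
    fix x assume "x \<in> set ?u"
    then obtain \<pi> where \<pi>: "\<pi> \<in> set ps" "x \<in> set (one_line n \<pi>)" by auto
    have "\<pi> permutes {1..n}" using \<pi>(1) ps by simp
    moreover obtain i where "i \<in> {1..n}" "x = \<pi> i"
      using \<pi>(2) unfolding one_line_def by fastforce
    ultimately show "x \<in> {1..n}" by (simp only: permutes_in_image)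
  qed
  ultimately have "universal_word n ?u" unfolding universal_word_def using inc_self by blast
  then show ?thesis by blast
qed

end

theory Submission imports Defs begin

text \<open>The \<open>d\<close> classes of a 1-cycle \<open>{f\<^sup>j(inc(\<pi>)). j < d}\<close> are read off successively from the
  periodic word \<open>\<pi>(1)\<dots>\<pi>(n)\<pi>(1)\<dots>\<pi>(d-1)\<close>, of length \<open>n + d - 1\<close>. Replacing \<open>\<pi>\<close> by another member
  of its class prescribes the first letter of this word, so the words of all 1-cycles can be chained
  with an overlap of one letter: each 1-cycle costs \<open>d + n - 2\<close> letters beyond the initial one.\<close>

text \<open>Bridge between two library notions of least period: the injective enumeration of an
  orbit is stated for \<open>funpow_dist1\<close>, divisibility of every period for
  \<open>least_power\<close>.\<close>

lemma funpow_dist1_eq_least_power: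
  assumes "(f ^^ n) x = x" "n > 0"
  shows "funpow_dist1 f x x = least_power f x"
proof (rule antisym)
  show "funpow_dist1 f x x \<le> least_power f x"
    using least_powerI[OF assms] funpow_dist1_least[of "least_power f x" f x x] by (meson not_le)
  show "least_power f x \<le> funpow_dist1 f x x"
    using funpow_dist1_prop1[OF assms] by (intro least_power_le) auto
qed

text \<open>The iterates below the least period are distinct, and the least period divides every
  period. For \<open>rot_class n\<close> the period is \<open>n\<close>, because
  \<open>sigma n ^^ n = id\<close>.\<close>

lemma periodic_orbit:
  assumes "(f ^^ n) x = x" "n > 0"
  shows "orbit f x = (\<lambda>i. (f ^^ i) x) ` {..<card (orbit f x)}" and "card (orbit f x) dvd n"
proof -
  have self: "x \<in> orbit f x" using assms by (force simp: orbit_altdef)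
  have orb: "orbit f x = (\<lambda>i. (f ^^ i) x) ` {0..<least_power f x}"
    using orbit_conv_funpow_dist1[OF self] by (simp only: funpow_dist1_eq_least_power[OF assms])
  have "inj_on (\<lambda>i. (f ^^ i) x) {0..<least_power f x}"
    using inj_on_funpow_dist1[OF self] by (simp only: funpow_dist1_eq_least_power[OF assms])
  then have "card (orbit f x) = least_power f x"
    by (subst orb) (simp add: card_image)
  then show "orbit f x = (\<lambda>i. (f ^^ i) x) ` {..<card (orbit f x)}" "card (orbit f x) dvd n"
    using orb least_power_minimal[OF assms(1)] by (simp_all add: lessThan_atLeast0)
qed

lemma rot_class_funpow_inc:
  assumes "n \<ge> 1"
  shows "(rot_class n ^^ j) (inc n \<pi>) = inc n (\<pi> \<circ> (sigma n ^^ j))"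
proof (induction j)
  case (Suc j)
  have "(rot_class n ^^ Suc j) (inc n \<pi>) = inc n (\<pi> \<circ> (sigma n ^^ j) \<circ> sigma n)"
    by (simp only: funpow.simps comp_apply[of "rot_class n"] Suc rot_class_inc[OF assms])
  then show ?case by (simp only: comp_assoc funpow_Suc_right)
qed simp

definition cycle_word :: "nat \<Rightarrow> (nat \<Rightarrow> nat) \<Rightarrow> nat \<Rightarrow> nat list" where
  "cycle_word n \<pi> d = map (\<lambda>i. \<pi> ((sigma n ^^ i) 1)) [0..<n + d - 1]"

lemma length_cycle_word [simp]: "length (cycle_word n \<pi> d) = n + d - 1"
  by (simp add: cycle_word_def)

text \<open>The window of length \<open>n\<close> at offset \<open>j\<close> has last index
  \<open>n + j - 1\<close>, which \<open>j < d\<close> keeps below the length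
  \<open>n + d - 1\<close>.\<close>

lemma sublist_cycle_word:
  assumes "j < d"
  shows "sublist (one_line n (\<pi> \<circ> (sigma n ^^ j))) (cycle_word n \<pi> d)"
proof -
  have "one_line n (\<pi> \<circ> (sigma n ^^ j)) = take n (drop j (cycle_word n \<pi> d))"
  proof (rule nth_equalityI)
    fix i assume "i < length (one_line n (\<pi> \<circ> (sigma n ^^ j)))"
    then have i: "i < n" by (simp add: one_line_def del: upt_Suc)
    \<comment> \<open>Both sides are \<open>(i + j) mod n + 1\<close>, since position
      \<open>Suc i\<close> is \<open>sigma n ^^ i\<close> applied to 1.\<close>
    then have "(sigma n ^^ j) (Suc i) = (sigma n ^^ (j + i)) 1"
      by (simp add: sigma_funpow add.commute)
    then show "one_line n (\<pi> \<circ> (sigma n ^^ j)) ! i = take n (drop j (cycle_word n \<pi> d)) ! i"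
      using i assms by (simp add: one_line_def cycle_word_def del: upt_Suc)
  qed (use assms in \<open>auto simp: one_line_def simp del: upt_Suc\<close>)
  then show ?thesis
    by (metis sublist_drop sublist_order.order_trans sublist_take)
qed

lemma set_cycle_word:
  assumes "n \<ge> 1" "\<pi> permutes {1..n}"
  shows "set (cycle_word n \<pi> d) \<subseteq> {1..n}"
proof -
  have "\<pi> ((sigma n ^^ i) 1) \<in> {1..n}" for i
    using assms permutes_in_image[OF assms(2)] permutes_in_image[OF sigma_funpow_permutes[of i n], of 1]
    by simp
  then show ?thesis by (auto simp: cycle_word_def)
qed

lemma inc_prescribed_value:
  assumes "\<pi> permutes {1..n}" "a \<in> {1..n}" "b \<in> {1..n}"
  obtains \<rho> where "\<rho> \<in> inc n \<pi>" "\<rho> a = b"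
proof
  have n: "n \<ge> 1" using assms by simp
  \<comment> \<open>This is \<open>b - \<pi> a\<close> modulo \<open>n\<close>; the extra
    \<open>n\<close> avoids truncated subtraction. As \<open>?k\<close> may exceed
    \<open>n - 1\<close>, membership goes through \<open>inc_altdef\<close>.\<close>
  let ?k = "b + n - \<pi> a"
  show "(sigma n ^^ ?k) \<circ> \<pi> \<in> inc n \<pi>" by (simp add: inc_altdef[OF n])
  have \<pi>a: "\<pi> a \<in> {1..n}" using assms permutes_in_image by metis
  then have "\<pi> a - 1 + ?k = (b - 1) + n" using assms(3) by auto
  then have "(\<pi> a - 1 + ?k) mod n = (b - 1) mod n" by simp
  also have "\<dots> = b - 1" using assms(3) by (intro mod_less) auto
  finally have "(\<pi> a - 1 + ?k) mod n + 1 = b" using assms(3) by simp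
  then show "((sigma n ^^ ?k) \<circ> \<pi>) a = b" by (simp add: sigma_funpow[OF \<pi>a])
qed

definition covers :: "nat \<Rightarrow> nat list \<Rightarrow> (nat \<Rightarrow> nat) set \<Rightarrow> bool" where
  "covers n u C \<longleftrightarrow> (\<exists>\<rho> \<in> C. sublist (one_line n \<rho>) u)"

lemma covers_mono: "covers n u C \<Longrightarrow> sublist u v \<Longrightarrow> covers n v C"
  unfolding covers_def using sublist_order.order_trans by blast

lemma extend_word:
  assumes n: "n \<ge> 1" and C: "C \<in> R2_classes n"
    and u: "u \<noteq> []" "set u \<subseteq> {1..n}"
  defines "Z \<equiv> orbit (rot_class n) C"
  obtains v where "set (u @ v) \<subseteq> {1..n}" "length v = card Z + n - 2"
    "\<And>D. D \<in> Z \<Longrightarrow> covers n (u @ v) D"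
proof -
  obtain \<pi> where \<pi>: "\<pi> permutes {1..n}" "C = inc n \<pi>"
    using C by (auto simp: R2_classes_def R2_def elim!: quotientE)
  have "last u \<in> {1..n}" using u last_in_set by blast
  \<comment> \<open>A class determines its words only up to a shift of values; this freedom makes
    the new word start with the last letter of \<open>u\<close>.\<close>
  then obtain \<rho> where \<rho>: "\<rho> \<in> inc n \<pi>" "\<rho> 1 = last u"
    using inc_prescribed_value[OF \<pi>(1), of 1] n by auto
  have C_eq: "C = inc n \<rho>" using inc_eq[OF n \<rho>(1)] \<pi>(2) by simp
  have "(rot_class n ^^ n) C = C"
    by (simp add: C_eq rot_class_funpow_inc[OF n] sigma_funpow_n)
  then have Z: "Z = (\<lambda>j. (rot_class n ^^ j) C) ` {..<card Z}"
    unfolding Z_def using n by (intro periodic_orbit(1)[of n]) auto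
  \<comment> \<open>If \<open>card Z\<close> were 0, whether for an empty or an infinite
    \<open>Z\<close>, the image above would make \<open>Z\<close> empty.\<close>
  then have "card Z > 0" by (metis Z_def image_empty lessThan_0 gr0I orbit_nonempty)
  let ?w = "cycle_word n \<rho> (card Z)"
  have len: "length ?w > 0" using n \<open>card Z > 0\<close> by simp
  then have hd: "hd ?w = last u" using \<rho>(2) by (simp add: hd_conv_nth cycle_word_def)
  \<comment> \<open>The shared letter is written once: \<open>?w\<close> stays intact as a suffix
    although only its tail is appended.\<close>
  have uw: "u @ tl ?w = butlast u @ ?w"
    using len u hd by (cases ?w; cases u rule: rev_cases) auto
  show thesis
  proof
    have "set ?w \<subseteq> {1..n}" by (rule set_cycle_word[OF n inc_permutes[OF \<pi>(1) \<rho>(1)]])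
    then show "set (u @ tl ?w) \<subseteq> {1..n}" using u(2) len list.set_sel(2)[of ?w]
      by fastforce
    show "length (tl ?w) = card Z + n - 2" by simp
    fix D assume "D \<in> Z"
    then obtain j where "j < card Z" "D = inc n (\<rho> \<circ> (sigma n ^^ j))"
      using Z by (auto simp: C_eq rot_class_funpow_inc[OF n])
    then have "covers n ?w D"
      unfolding covers_def using inc_self sublist_cycle_word by blast
    then show "covers n (u @ tl ?w) D" unfolding uw by (rule covers_mono) simp
  qed
qed

text \<open>The orbits can be chained in any order: \<open>extend_word\<close> only asks for a
  nonempty word over the alphabet, and classes already covered stay covered when letters are
  appended.\<close>

lemma covering_word:
  assumes n: "n \<ge> 1" and "finite F" "F \<subseteq> orbit (rot_class n) ` R2_classes n"
  shows "\<exists>u. u \<noteq> [] \<and> set u \<subseteq> {1..n} \<and> length u = 1 + (\<Sum>Z\<in>F. card Z + n - 2) \<and>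
    (\<forall>D \<in> \<Union>F. covers n u D)"
  using assms(2,3)
proof (induction F rule: finite_induct)
  case empty
  \<comment> \<open>Any single letter would do; it accounts for the leading 1 in the length.\<close>
  show ?case using n by (intro exI[of _ "[1]"]) simp
next
  case (insert Z F)
  then obtain u where u: "u \<noteq> []" "set u \<subseteq> {1..n}" "length u = 1 + (\<Sum>Z\<in>F. card Z + n - 2)"
    "\<forall>D \<in> \<Union>F. covers n u D" by auto
  obtain C where "C \<in> R2_classes n" "Z = orbit (rot_class n) C" using insert.prems by auto
  then obtain v where v: "set (u @ v) \<subseteq> {1..n}" "length v = card Z + n - 2"
    "\<And>D. D \<in> Z \<Longrightarrow> covers n (u @ v) D"
    using extend_word[OF n _ u(1,2)] by metis
  have "covers n (u @ v) D" if "D \<in> \<Union>(insert Z F)" for D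
    using that u(4) v(3) covers_mono[of n u D "u @ v"] by auto
  then show ?case
    using u v insert.hyps by (intro exI[of _ "u @ v"]) simp
qed

theorem theorem5:
  fixes n :: nat
  assumes "n \<ge> 1"
  shows "min_universal_length n \<le> 1 + (\<Sum>d | d dvd n. card (cycles1 n d) * (d + n - 2))"
proof -
  let ?F = "orbit (rot_class n) ` R2_classes n"
  have period: "(rot_class n ^^ n) C = C" if "C \<in> R2_classes n" for C
    using that by (auto simp: R2_classes_def R2_def rot_class_funpow_inc[OF assms] sigma_funpow_n
        elim!: quotientE)
  have inc_class: "inc n \<pi> \<in> R2_classes n" if "\<pi> permutes {1..n}" for \<pi>
    using that quotientI[of \<pi> "{\<pi>. \<pi> permutes {1..n}}" "R2 n"]
    by (simp add: R2_classes_def R2_def Image_def)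
  have "R2_classes n \<subseteq> inc n ` {\<pi>. \<pi> permutes {1..n}}"
    by (auto simp: R2_classes_def R2_def elim!: quotientE)
  then have fin: "finite ?F"
    by (intro finite_imageI) (rule finite_surj[OF finite_permutations], auto)
  obtain u where u: "set u \<subseteq> {1..n}" "length u = 1 + (\<Sum>Z\<in>?F. card Z + n - 2)"
    "\<forall>D \<in> \<Union>?F. covers n u D"
    using covering_word[OF assms fin] by auto
  have "covers n u (inc n \<pi>)" if "\<pi> permutes {1..n}" for \<pi>
  proof -
    \<comment> \<open>\<open>orbit\<close> starts with the first iterate, so a class lies in its own
      orbit only by recurrence, here after \<open>n\<close> steps.\<close>
    have "inc n \<pi> \<in> orbit (rot_class n) (inc n \<pi>)"
      using period[OF inc_class[OF that]] assms by (force simp: orbit_altdef)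
    then show ?thesis using u(3) inc_class[OF that] by blast
  qed
  then have "universal_word n u" using u(1) by (simp add: universal_word_def covers_def)
  then have "min_universal_length n \<le> length u"
    unfolding min_universal_length_def by (intro Least_le) blast
  also note u(2)
  \<comment> \<open>Orbits are grouped by size; none is lost, because each size divides
    \<open>n\<close>.\<close>
  also have "(\<Sum>Z\<in>?F. card Z + n - 2)
      = (\<Sum>d | d dvd n. \<Sum>Z | Z \<in> ?F \<and> card Z = d. card Z + n - 2)"
    using assms periodic_orbit(2)[OF period] fin by (intro sum.group[symmetric]) auto
  also have "\<dots> = (\<Sum>d | d dvd n. card (cycles1 n d) * (d + n - 2))"
  proof (rule sum.cong[OF refl])
    fix d
    have "{Z. Z \<in> ?F \<and> card Z = d} = cycles1 n d" by (auto simp: cycles1_def)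
    moreover have "(\<Sum>Z | Z \<in> ?F \<and> card Z = d. card Z + n - 2)
        = (\<Sum>Z | Z \<in> ?F \<and> card Z = d. d + n - 2)"
      by (rule sum.cong) auto
    ultimately show "(\<Sum>Z | Z \<in> ?F \<and> card Z = d. card Z + n - 2)
        = card (cycles1 n d) * (d + n - 2)"
      by simp
  qed
  finally show ?thesis .
qed

end
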